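(* Let $R$ be an integral domain. If there exists a connected graph $G$ that is neither a tree nor a cycle such that $(G,\alpha)$ satisfies the Universal Difference Property for every edge-labeling $\alpha$ of $G$ over $R$, then $R$ is a Prüfer domain.
   Context: An integral domain $R$ is a Prüfer domain if for all nonzero ideals $I,J,K$ of $R$, $I\cap(J+K)=(I\cap J)+(I\cap K)$. An edge-labeling assigns to each edge an ideal of $R$. A spline on $(G,\alpha)$ is a function $\rho:V(G)\to R$ with $\rho(u)-\rho(v)\in\alpha(uv)$ for every edge $uv$. A path has no repeated vertices; for a path $P$, $\alpha(P)$ is the sum of the labels of its edges. $(G,\alpha)$ satisfies the Universal Difference Property if for every pair of vertices $u,w$ and every $x\in\bigcap_P\alpha(P)$ (over all paths $P$ from $u$ to $w$ in $G$) there is a spline $\rho$ with $\rho(u)-\rho(w)=x$. *)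

theory Defs
  imports "HOL-Algebra.Algebra"
begin

definition prufer_domain :: "('a, 'm) ring_scheme \<Rightarrow> bool" where
  "prufer_domain R \<longleftrightarrow> domain R \<and>
     (\<forall>I J K. ideal I R \<and> I \<noteq> {\<zero>\<^bsub>R\<^esub>} \<and> ideal J R \<and> J \<noteq> {\<zero>\<^bsub>R\<^esub>} \<and> ideal K R \<and> K \<noteq> {\<zero>\<^bsub>R\<^esub>} \<longrightarrow>
        I \<inter> (J <+>\<^bsub>R\<^esub> K) = (I \<inter> J) <+>\<^bsub>R\<^esub> (I \<inter> K))"

text \<open>A graph is a vertex set \<open>V\<close> with a set \<open>E\<close> of two-element subsets of \<open>V\<close>.
  Finiteness is not required.\<close>

definition simple_graph :: "'v set \<Rightarrow> 'v set set \<Rightarrow> bool" where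
  "simple_graph V E \<longleftrightarrow> (\<forall>e\<in>E. e \<subseteq> V \<and> card e = 2)"

definition consecutive_edges :: "'v list \<Rightarrow> 'v set list" where
  "consecutive_edges p = map (\<lambda>i. {p ! i, p ! Suc i}) [0..<length p - 1]"

text \<open>A path is given by its list of vertices; the one-vertex list is the trivial path.\<close>

definition graph_path :: "'v set \<Rightarrow> 'v set set \<Rightarrow> 'v \<Rightarrow> 'v \<Rightarrow> 'v list \<Rightarrow> bool" where
  "graph_path V E u w p \<longleftrightarrow>
     p \<noteq> [] \<and> hd p = u \<and> last p = w \<and> distinct p \<and> set p \<subseteq> V \<and> set (consecutive_edges p) \<subseteq> E"

definition connected_graph :: "'v set \<Rightarrow> 'v set set \<Rightarrow> bool" where
  "connected_graph V E \<longleftrightarrow> V \<noteq> {} \<and> (\<forall>u\<in>V. \<forall>w\<in>V. \<exists>p. graph_path V E u w p)"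

text \<open>The edges of the cycle through the vertices \<open>c\<close>, closed up from the last to the first.\<close>

definition cycle_edges :: "'v list \<Rightarrow> 'v set set" where
  "cycle_edges c = insert {last c, hd c} (set (consecutive_edges c))"

definition cycle_in :: "'v set \<Rightarrow> 'v set set \<Rightarrow> 'v list \<Rightarrow> bool" where
  "cycle_in V E c \<longleftrightarrow> 3 \<le> length c \<and> distinct c \<and> set c \<subseteq> V \<and> cycle_edges c \<subseteq> E"

definition tree_graph :: "'v set \<Rightarrow> 'v set set \<Rightarrow> bool" where
  "tree_graph V E \<longleftrightarrow> connected_graph V E \<and> (\<nexists>c. cycle_in V E c)"

definition cycle_graph :: "'v set \<Rightarrow> 'v set set \<Rightarrow> bool" where
  "cycle_graph V E \<longleftrightarrow> (\<exists>c. 3 \<le> length c \<and> distinct c \<and> V = set c \<and> E = cycle_edges c)"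

definition edge_labeling ::
  "('a, 'm) ring_scheme \<Rightarrow> 'v set set \<Rightarrow> ('v set \<Rightarrow> 'a set) \<Rightarrow> bool" where
  "edge_labeling R E \<alpha> \<longleftrightarrow> (\<forall>e\<in>E. ideal (\<alpha> e) R)"

definition spline ::
  "('a, 'm) ring_scheme \<Rightarrow> 'v set \<Rightarrow> 'v set set \<Rightarrow> ('v set \<Rightarrow> 'a set) \<Rightarrow> ('v \<Rightarrow> 'a) \<Rightarrow> bool" where
  "spline R V E \<alpha> \<rho> \<longleftrightarrow>
     \<rho> \<in> V \<rightarrow> carrier R \<and> (\<forall>u v. {u, v} \<in> E \<longrightarrow> \<rho> u \<ominus>\<^bsub>R\<^esub> \<rho> v \<in> \<alpha> {u, v})"

text \<open>The sum of the labels along a path; the trivial path gets the zero ideal.\<close>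

definition path_label ::
  "('a, 'm) ring_scheme \<Rightarrow> ('v set \<Rightarrow> 'a set) \<Rightarrow> 'v list \<Rightarrow> 'a set" where
  "path_label R \<alpha> p = foldr (\<lambda>e S. \<alpha> e <+>\<^bsub>R\<^esub> S) (consecutive_edges p) {\<zero>\<^bsub>R\<^esub>}"

text \<open>Intersecting with the carrier makes an empty family of paths yield all of \<open>R\<close>.\<close>

definition universal_difference_property ::
  "('a, 'm) ring_scheme \<Rightarrow> 'v set \<Rightarrow> 'v set set \<Rightarrow> ('v set \<Rightarrow> 'a set) \<Rightarrow> bool" where
  "universal_difference_property R V E \<alpha> \<longleftrightarrow>
     (\<forall>u\<in>V. \<forall>w\<in>V. \<forall>x \<in> carrier R \<inter> (\<Inter>p\<in>{p. graph_path V E u w p}. path_label R \<alpha> p).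
        \<exists>\<rho>. spline R V E \<alpha> \<rho> \<and> \<rho> u \<ominus>\<^bsub>R\<^esub> \<rho> w = x)"

end

theory Submission imports Defs begin

text \<open>
  In \<open>G\<close> one finds distinct vertices \<open>s\<close>, \<open>t\<close>, a neighbour \<open>v\<close> of \<open>s\<close> and two neighbours
  \<open>p \<noteq> q\<close> of \<open>t\<close> such that \<open>v\<close>, \<open>p\<close>, \<open>q\<close> lie in one component of \<open>G - {s, t}\<close>: take a cycle; if
  it misses a vertex, some \<open>s\<close> off the cycle is adjacent to a cycle vertex \<open>v\<close>, and \<open>t\<close> is a
  neighbour of \<open>v\<close> on the cycle; if it has a chord, \<open>s\<close> and \<open>t\<close> are the successors on the cycle of
  the two ends of the chord.

  Label \<open>st\<close> (if it is an edge) by \<open>R\<close>, all other edges at \<open>s\<close> by \<open>J\<close>, the edge \<open>tp\<close> by \<open>A\<close>, all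
  other edges at \<open>t\<close> by \<open>B\<close>, and the rest by \<open>0\<close>. Every path from \<open>s\<close> to \<open>t\<close> has a label containing
  \<open>(J + A) \<inter> (J + B)\<close>, whereas a spline takes a common value at \<open>v\<close>, \<open>p\<close>, \<open>q\<close>, so
  that its difference between \<open>s\<close> and \<open>t\<close> lies in \<open>J + (A \<inter> B)\<close>. Hence \<open>+\<close> distributes over \<open>\<inter>\<close>,
  and the dual distributive law follows as in any modular lattice.
\<close>

section \<open>Edges along vertex lists, cycles and paths\<close>

lemma consecutive_edges_singleton [simp]: "consecutive_edges [a] = []"
  by (simp add: consecutive_edges_def)

lemma consecutive_edges_Cons_Cons [simp]:
  "consecutive_edges (a # b # l) = {a, b} # consecutive_edges (b # l)"
proof -
  have "[0..<length (a # b # l) - 1] = 0 # map Suc [0..<length l]"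
    by (simp add: map_Suc_upt upt_conv_Cons del: upt_Suc)
  then show ?thesis by (simp add: consecutive_edges_def)
qed

lemma set_consecutive_edges_append:
  assumes "xs \<noteq> []" and "ys \<noteq> []"
  shows "set (consecutive_edges (xs @ ys)) =
           insert {last xs, hd ys} (set (consecutive_edges xs) \<union> set (consecutive_edges ys))"
  using assms
proof (induction xs rule: list_nonempty_induct)
  case (single x)
  then show ?case by (cases ys) auto
next
  case (cons x xs)
  then show ?case by (cases xs) auto
qed

text \<open>The old closing edge becomes a consecutive one, and the old first edge becomes the
  closing one.\<close>

lemma cycle_edges_rotate1: "cycle_edges (rotate1 c) = cycle_edges c"
proof (cases c)
  case (Cons a l)
  then show ?thesis
  proof (cases l)
    case (Cons b m)
    then show ?thesis
      using \<open>c = a # l\<close> set_consecutive_edges_append[of "b # m" "[a]"]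
      by (auto simp: cycle_edges_def)
  qed auto
qed auto

lemma cycle_edges_rotate: "cycle_edges (rotate k c) = cycle_edges c"
  by (induction k) (auto simp: cycle_edges_rotate1)

lemma cycle_in_rotate_to:
  assumes "cycle_in V E c" and "a \<in> set c"
  obtains l where "cycle_in V E (a # l)" and "set (a # l) = set c"
    and "cycle_edges (a # l) = cycle_edges c"
proof -
  obtain k where k: "k < length c" "c ! k = a"
    using assms(2) by (metis in_set_conv_nth)
  then have "c \<noteq> []" by auto
  with k have "hd (rotate k c) = a" and "rotate k c \<noteq> []"
    by (simp_all add: hd_rotate_conv_nth)
  then obtain l where l: "rotate k c = a # l"
    by (metis list.collapse)
  show thesis
  proof
    show "set (a # l) = set c" and "cycle_edges (a # l) = cycle_edges c"
      using set_rotate[of k c] cycle_edges_rotate[of k c] l by simp_all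
    moreover have "length (a # l) = length c" and "distinct (a # l) = distinct c"
      using length_rotate[of k c] distinct_rotate[of k c] l by simp_all
    ultimately show "cycle_in V E (a # l)"
      using assms(1) unfolding cycle_in_def by metis
  qed
qed

text \<open>A discrete intermediate value argument. It supplies edges at both ends of a path and an
  edge attaching an outside vertex to a cycle.\<close>

lemma path_enters_set:
  assumes "p \<noteq> []" and "hd p \<notin> C" and "last p \<in> C"
  obtains x y where "x \<notin> C" and "y \<in> C" and "{x, y} \<in> set (consecutive_edges p)"
proof -
  have "\<exists>x y. x \<notin> C \<and> y \<in> C \<and> {x, y} \<in> set (consecutive_edges p)"
    using assms
  proof (induction p rule: list_nonempty_induct)
    case (cons a p)
    obtain b l where p: "p = b # l" using cons.hyps by (cases p) auto
    show ?case
    proof (cases "b \<in> C")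
      case True
      then show ?thesis using cons.prems p by (intro exI[of _ a] exI[of _ b]) simp
    next
      case False
      then obtain x y where "x \<notin> C" "y \<in> C" "{x, y} \<in> set (consecutive_edges p)"
        using cons p by auto
      then show ?thesis using p by (intro exI[of _ x] exI[of _ y]) simp
    qed
  qed simp
  then show thesis using that by blast
qed

lemma path_first_edge:
  assumes "graph_path V E u w p" and "u \<noteq> w"
  obtains a where "{u, a} \<in> set (consecutive_edges p)"
proof -
  \<comment> \<open>Entering the complement of \<open>{u}\<close> means leaving
    \<open>u\<close>.\<close>
  have "p \<noteq> []" "hd p \<notin> - {u}" "last p \<in> - {u}"
    using assms by (auto simp: graph_path_def)
  then obtain x a where "x \<notin> - {u}" and "{x, a} \<in> set (consecutive_edges p)"
    by (rule path_enters_set)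
  then have "{u, a} \<in> set (consecutive_edges p)" by simp
  then show thesis by (rule that)
qed

lemma path_last_edge:
  assumes "graph_path V E u w p" and "u \<noteq> w"
  obtains b where "{w, b} \<in> set (consecutive_edges p)"
proof -
  have "p \<noteq> []" "hd p \<notin> {w}" "last p \<in> {w}"
    using assms by (auto simp: graph_path_def)
  then obtain b y where "y \<in> {w}" and "{b, y} \<in> set (consecutive_edges p)"
    by (rule path_enters_set)
  then have "{w, b} \<in> set (consecutive_edges p)" by (simp add: insert_commute)
  then show thesis by (rule that)
qed

section \<open>The fork configuration in the graph\<close>

text \<open>Outside \<open>S\<close>, the reflexive transitive closure is connectivity in the graph
  with \<open>S\<close> deleted.\<close>

definition adjacent_off :: "'v set set \<Rightarrow> 'v set \<Rightarrow> 'v \<Rightarrow> 'v \<Rightarrow> bool" where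
  "adjacent_off E S a b \<longleftrightarrow> {a, b} \<in> E \<and> a \<notin> S \<and> b \<notin> S"

lemma list_connected_off:
  assumes "p \<noteq> []" and "set (consecutive_edges p) \<subseteq> E" and "set p \<inter> S = {}"
  shows "(adjacent_off E S)\<^sup>*\<^sup>* (hd p) (last p)"
  using assms
proof (induction p rule: list_nonempty_induct)
  case (cons a p)
  then obtain b l where p: "p = b # l" by (cases p) auto
  with cons.prems have "adjacent_off E S a b" by (auto simp: adjacent_off_def)
  with cons p show ?case by (auto intro: converse_rtranclp_into_rtranclp)
qed auto

text \<open>There are two distinctness clauses because \<open>v\<close> may coincide with
  \<open>p\<close> or \<open>q\<close>.\<close>

definition fork_configuration :: "'v set set \<Rightarrow> 'v \<Rightarrow> 'v \<Rightarrow> 'v \<Rightarrow> 'v \<Rightarrow> 'v \<Rightarrow> bool" where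
  "fork_configuration E s t v p q \<longleftrightarrow>
     distinct [s, t, v] \<and> distinct [s, t, p, q] \<and> {s, v} \<in> E \<and> {t, p} \<in> E \<and> {t, q} \<in> E \<and>
     (adjacent_off E {s, t})\<^sup>*\<^sup>* v p \<and> (adjacent_off E {s, t})\<^sup>*\<^sup>* q v"

text \<open>Write the cycle as \<open>v\<close>, \<open>t\<close>, \<open>q\<close>,
  \<open>m\<close> and take \<open>p = v\<close>. The arc from \<open>q\<close> through
  \<open>m\<close> back to \<open>v\<close> avoids \<open>t\<close>, and it avoids \<open>s\<close>
  because \<open>s\<close> is off the cycle.\<close>

lemma fork_configuration_pendant:
  assumes cyc: "cycle_in V E c" and "v \<in> set c" and "s \<notin> set c" and sv: "{s, v} \<in> E"
  obtains t p q where "fork_configuration E s t v p q"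
proof -
  obtain l where l: "cycle_in V E (v # l)" "set (v # l) = set c"
    using cycle_in_rotate_to[OF cyc \<open>v \<in> set c\<close>] by metis
  then obtain t q m where m: "l = t # q # m"
    by (auto simp: cycle_in_def Suc_le_length_iff numeral_3_eq_3)
  have "set (consecutive_edges ((q # m) @ [v])) \<subseteq> E"
    using l(1) set_consecutive_edges_append[of "q # m" "[v]"]
    by (auto simp: m cycle_in_def cycle_edges_def)
  then have "(adjacent_off E {s, t})\<^sup>*\<^sup>* q v"
    using list_connected_off[of "(q # m) @ [v]" E "{s, t}"] l \<open>s \<notin> set c\<close>
    by (auto simp: m cycle_in_def)
  then have "fork_configuration E s t v v q"
    using l \<open>s \<notin> set c\<close> sv
    by (auto simp: m fork_configuration_def cycle_in_def cycle_edges_def insert_commute)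
  then show thesis by (rule that)
qed

text \<open>Write the cycle as \<open>a\<close>, \<open>s\<close>, \<open>m1\<close>,
  \<open>b\<close>, \<open>t\<close>, \<open>m2\<close>. The chord joins \<open>v = a\<close> to
  \<open>p = b\<close>, and the arc after \<open>t\<close> leads from \<open>q\<close> back to
  \<open>a\<close>.\<close>

lemma fork_configuration_chord:
  assumes cyc: "cycle_in V E c" and "a \<in> set c" and "b \<in> set c" and "a \<noteq> b"
    and ab: "{a, b} \<in> E" "{a, b} \<notin> cycle_edges c"
  obtains s t q where "fork_configuration E s t a b q"
proof -
  obtain l where l: "cycle_in V E (a # l)" "set (a # l) = set c"
      "cycle_edges (a # l) = cycle_edges c"
    using cycle_in_rotate_to[OF cyc \<open>a \<in> set c\<close>] by metis
  then obtain l1 l2 where l12: "l = l1 @ b # l2"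
    using \<open>b \<in> set c\<close> \<open>a \<noteq> b\<close> by (metis set_ConsD split_list)
  have ab': "{a, b} \<notin> cycle_edges (a # l1 @ b # l2)"
    using ab(2) l(3) l12 by simp
  \<comment> \<open>If \<open>l1\<close> were empty, \<open>b\<close> would follow \<open>a\<close>
    on the cycle; if \<open>l2\<close> were empty, \<open>{a, b}\<close> would be the closing
    edge.\<close>
  have "l1 \<noteq> []"
    using ab' by (auto simp: cycle_edges_def)
  then obtain s m1 where m1: "l1 = s # m1" by (cases l1) auto
  have "l2 \<noteq> []"
    using ab' by (auto simp: cycle_edges_def insert_commute)
  then obtain t m2 where m2: "l2 = t # m2" by (cases l2) auto
  \<comment> \<open>The successor of \<open>t\<close> on the cycle, which is \<open>a\<close> itself
    when \<open>m2\<close> is empty.\<close>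
  define q where "q = hd (m2 @ [a])"
  have dist: "distinct (a # s # m1 @ b # t # m2)"
    using l(1) by (simp add: cycle_in_def l12 m1 m2)
  have edges: "cycle_edges (a # s # m1 @ b # t # m2) \<subseteq> E"
    using l(1) by (simp add: cycle_in_def l12 m1 m2)
  have "set (consecutive_edges (b # t # m2)) \<subseteq> E"
    using edges set_consecutive_edges_append[of "s # m1" "b # t # m2"]
    by (auto simp: cycle_edges_def)
  moreover have "{last (t # m2), a} \<in> E"
    using edges by (auto simp: cycle_edges_def)
  ultimately have arc: "set (consecutive_edges (t # m2 @ [a])) \<subseteq> E" and "{t, b} \<in> E"
    using set_consecutive_edges_append[of "t # m2" "[a]"] by (auto simp: insert_commute)
  then have "{t, q} \<in> E" and arc': "set (consecutive_edges (m2 @ [a])) \<subseteq> E"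
    by (cases m2; auto simp: q_def)+
  have "(adjacent_off E {s, t})\<^sup>*\<^sup>* q a"
    using list_connected_off[OF _ arc', of "{s, t}"] dist by (auto simp: q_def)
  moreover have "(adjacent_off E {s, t})\<^sup>*\<^sup>* a b"
    using ab(1) dist by (auto simp: adjacent_off_def)
  moreover have "{s, a} \<in> E"
    using edges by (auto simp: cycle_edges_def insert_commute)
  moreover have "distinct [s, t, a]" "distinct [s, t, b, q]"
    using dist by (cases m2; auto simp: q_def)+
  ultimately have "fork_configuration E s t a b q"
    using \<open>{t, b} \<in> E\<close> \<open>{t, q} \<in> E\<close> unfolding fork_configuration_def by blast
  then show thesis by (rule that)
qed

lemma fork_configuration_exists:
  assumes graph: "simple_graph V E" and conn: "connected_graph V E"
    and "\<not> tree_graph V E" and "\<not> cycle_graph V E"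
  obtains s t v p q where "fork_configuration E s t v p q"
proof -
  obtain c where cyc: "cycle_in V E c"
    using assms by (auto simp: tree_graph_def)
  then have c: "3 \<le> length c" "distinct c" "set c \<subseteq> V" "cycle_edges c \<subseteq> E"
    by (auto simp: cycle_in_def)
  show thesis
  proof (cases "set c = V")
    case True
    with c \<open>\<not> cycle_graph V E\<close> obtain e where e: "e \<in> E" "e \<notin> cycle_edges c"
      unfolding cycle_graph_def by blast
    with graph have "e \<subseteq> set c" "card e = 2"
      using True by (auto simp: simple_graph_def)
    then obtain a b where "e = {a, b}" "a \<noteq> b" "a \<in> set c" "b \<in> set c"
      by (auto simp: card_2_iff)
    with e show thesis
      using fork_configuration_chord[OF cyc] that by metis
  next
    case False
    with c obtain u where u: "u \<in> V" "u \<notin> set c" by blast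
    have "hd c \<in> set c" using c(1) by (cases c) auto
    then obtain P where P: "graph_path V E u (hd c) P"
      using conn c u unfolding connected_graph_def by blast
    then obtain s v where "s \<notin> set c" "v \<in> set c" "{s, v} \<in> set (consecutive_edges P)"
      using path_enters_set[of P "set c"] u \<open>hd c \<in> set c\<close> unfolding graph_path_def by metis
    moreover from this P have "{s, v} \<in> E" by (auto simp: graph_path_def)
    ultimately show thesis
      using fork_configuration_pendant[OF cyc] that by metis
  qed
qed

section \<open>Ideal sums, path labels and distributivity\<close>

context ring
begin

lemma mem_set_add_iff: "x \<in> A <+>\<^bsub>R\<^esub> B \<longleftrightarrow> (\<exists>a\<in>A. \<exists>b\<in>B. x = a \<oplus> b)"
  by (auto simp: set_add_def')

lemma set_add_ideal_upper1: "ideal I R \<Longrightarrow> ideal J R \<Longrightarrow> I \<subseteq> I <+>\<^bsub>R\<^esub> J"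
  using union_genideal[of I J] genideal_self[of "I \<union> J"]
  by (metis Un_subset_iff ideal.Icarr subsetI)

lemma set_add_ideal_upper2: "ideal I R \<Longrightarrow> ideal J R \<Longrightarrow> J \<subseteq> I <+>\<^bsub>R\<^esub> J"
  using union_genideal[of I J] genideal_self[of "I \<union> J"]
  by (metis Un_subset_iff ideal.Icarr subsetI)

lemma set_add_ideal_least: "ideal K R \<Longrightarrow> I \<subseteq> K \<Longrightarrow> J \<subseteq> K \<Longrightarrow> I <+>\<^bsub>R\<^esub> J \<subseteq> K"
  by (auto simp: mem_set_add_iff
      intro!: additive_subgroup.a_closed[OF ideal.axioms(1)])

lemma foldr_set_add_ideal:
  assumes "\<forall>e\<in>set es. ideal (\<alpha> e) R"
  shows "ideal (foldr (\<lambda>e S. \<alpha> e <+>\<^bsub>R\<^esub> S) es {\<zero>}) R"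
  using assms by (induction es) (auto intro: zeroideal add_ideals)

lemma subset_foldr_set_add:
  assumes "\<forall>e\<in>set es. ideal (\<alpha> e) R" and "e \<in> set es"
  shows "\<alpha> e \<subseteq> foldr (\<lambda>e S. \<alpha> e <+>\<^bsub>R\<^esub> S) es {\<zero>}"
  using assms
proof (induction es)
  case (Cons f es)
  then have "ideal (foldr (\<lambda>e S. \<alpha> e <+>\<^bsub>R\<^esub> S) es {\<zero>}) R"
    by (intro foldr_set_add_ideal) auto
  moreover have "ideal (\<alpha> f) R" using Cons.prems by simp
  ultimately show ?case
    using Cons set_add_ideal_upper1 set_add_ideal_upper2 by (cases "e = f") (simp, force)
qed auto

lemma path_label_ideal:
  assumes "edge_labeling R E \<alpha>" and "graph_path V E u w p"
  shows "ideal (path_label R \<alpha> p) R"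
  using assms unfolding path_label_def edge_labeling_def graph_path_def
  by (intro foldr_set_add_ideal) auto

lemma label_subset_path_label:
  assumes "edge_labeling R E \<alpha>" and "graph_path V E u w p" and "e \<in> set (consecutive_edges p)"
  shows "\<alpha> e \<subseteq> path_label R \<alpha> p"
  using assms unfolding path_label_def edge_labeling_def graph_path_def
  by (intro subset_foldr_set_add) auto

lemma sum_inf_distrib_of_UDP:
  assumes graph: "simple_graph V E" and fork: "fork_configuration E s t v p q"
    and UDP: "\<And>\<alpha>. edge_labeling R E \<alpha> \<Longrightarrow> universal_difference_property R V E \<alpha>"
    and J: "ideal J R" and A: "ideal A R" and B: "ideal B R"
  shows "(J <+>\<^bsub>R\<^esub> A) \<inter> (J <+>\<^bsub>R\<^esub> B) \<subseteq> J <+>\<^bsub>R\<^esub> (A \<inter> B)"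
proof
  fix x assume x: "x \<in> (J <+>\<^bsub>R\<^esub> A) \<inter> (J <+>\<^bsub>R\<^esub> B)"
  \<comment> \<open>The order of the cases matters: \<open>{t, p}\<close> is tested before the other
    edges at \<open>t\<close>, so \<open>{t, q}\<close> gets \<open>B\<close>. The label
    \<open>carrier R\<close> on \<open>{s, t}\<close> leaves splines unconstrained there.\<close>
  define \<alpha> where "\<alpha> e = (if e = {s, t} then carrier R else if s \<in> e then J
      else if e = {t, p} then A else if t \<in> e then B else {\<zero>})" for e
  have ne: "s \<noteq> t" "s \<noteq> v" "t \<noteq> v" "s \<noteq> p" "s \<noteq> q" "t \<noteq> p" "t \<noteq> q" "p \<noteq> q"
    and edges: "{s, v} \<in> E" "{t, p} \<in> E" "{t, q} \<in> E"
    and conn: "(adjacent_off E {s, t})\<^sup>*\<^sup>* v p" "(adjacent_off E {s, t})\<^sup>*\<^sup>* q v"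
    using fork by (auto simp: fork_configuration_def)
  have V: "e \<subseteq> V" if "e \<in> E" for e using graph that by (auto simp: simple_graph_def)
  have lab: "edge_labeling R E \<alpha>"
    unfolding edge_labeling_def \<alpha>_def using J A B by (auto intro: oneideal zeroideal)
  have xR: "x \<in> carrier R"
    using x ideal.Icarr[OF add_ideals[OF J A]] by blast
  have "x \<in> path_label R \<alpha> P" if P: "graph_path V E s t P" for P
  proof -
    note I = path_label_ideal[OF lab P] and sub = label_subset_path_label[OF lab P]
    \<comment> \<open>One edge at each end of the path is enough: either \<open>{s, t}\<close> is
      traversed and the label is all of \<open>R\<close>, or the label contains \<open>J\<close>
      together with \<open>A\<close> or \<open>B\<close>.\<close>
    obtain a where a: "{s, a} \<in> set (consecutive_edges P)"
      using path_first_edge[OF P ne(1)] .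
    obtain b where b: "{t, b} \<in> set (consecutive_edges P)"
      using path_last_edge[OF P ne(1)] .
    show ?thesis
    proof (cases "a = t \<or> b = s")
      case True
      then have "{s, t} \<in> set (consecutive_edges P)"
        using a b by (auto simp: insert_commute)
      then show ?thesis using sub xR by (fastforce simp: \<alpha>_def)
    next
      case False
      then have "\<alpha> {s, a} = J" "\<alpha> {t, b} = A \<or> \<alpha> {t, b} = B"
        using ne by (auto simp: \<alpha>_def doubleton_eq_iff)
      then have "J <+>\<^bsub>R\<^esub> A \<subseteq> path_label R \<alpha> P \<or> J <+>\<^bsub>R\<^esub> B \<subseteq> path_label R \<alpha> P"
        using sub[OF a] sub[OF b] set_add_ideal_least[OF I] by metis
      then show ?thesis using x by blast
    qed
  qed
  then obtain \<rho> where \<rho>: "spline R V E \<alpha> \<rho>" "\<rho> s \<ominus> \<rho> t = x"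
    using UDP[OF lab] V edges xR unfolding universal_difference_property_def by blast
  have cl: "\<rho> u \<in> carrier R" if "u \<in> V" for u using \<rho> that by (auto simp: spline_def)
  have diff: "\<rho> a \<ominus> \<rho> b \<in> \<alpha> {a, b}" if "{a, b} \<in> E" for a b
    using \<rho> that by (auto simp: spline_def)
  \<comment> \<open>Edges avoiding \<open>s\<close> and \<open>t\<close> carry the zero ideal, so
    \<rho> is constant on components of the graph without these two vertices.\<close>
  have step: "\<rho> a = \<rho> b" if "adjacent_off E {s, t} a b" for a b
  proof -
    have "{a, b} \<in> E" "\<alpha> {a, b} = {\<zero>}"
      using that by (auto simp: adjacent_off_def \<alpha>_def doubleton_eq_iff)
    with diff[of a b] V[of "{a, b}"] cl show ?thesis
      by (auto simp: r_right_minus_eq)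
  qed
  have const: "\<rho> a = \<rho> b" if "(adjacent_off E {s, t})\<^sup>*\<^sup>* a b" for a b
    using that by (induction rule: rtranclp_induct) (auto dest: step)
  have V': "s \<in> V" "t \<in> V" "v \<in> V" using V edges by blast+
  have val: "\<rho> p = \<rho> v" "\<rho> q = \<rho> v" using const conn by metis+
  have "\<alpha> {s, v} = J" "\<alpha> {p, t} = A" "\<alpha> {q, t} = B"
    using ne by (auto simp: \<alpha>_def doubleton_eq_iff)
  then have "\<rho> s \<ominus> \<rho> v \<in> J" "\<rho> v \<ominus> \<rho> t \<in> A \<inter> B"
    using diff[of s v] diff[of p t] diff[of q t] edges val by (auto simp: insert_commute)
  moreover have "x = (\<rho> s \<ominus> \<rho> v) \<oplus> (\<rho> v \<ominus> \<rho> t)"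
    using \<rho>(2) cl V' by (auto simp: minus_eq a_assoc r_neg1)
  ultimately show "x \<in> J <+>\<^bsub>R\<^esub> (A \<inter> B)" by (auto simp: mem_set_add_iff)
qed

text \<open>The law is applied twice: first with \<open>K\<close> as the common summand, after
  enlarging \<open>I\<close> to \<open>K + I\<close>, then with \<open>I \<inter> J\<close> as the
  common summand. The converse inclusion is monotonicity.\<close>

lemma inf_sum_distrib_of_sum_inf_distrib:
  assumes dist: "\<And>J A B. ideal J R \<Longrightarrow> ideal A R \<Longrightarrow> ideal B R \<Longrightarrow>
      (J <+>\<^bsub>R\<^esub> A) \<inter> (J <+>\<^bsub>R\<^esub> B) \<subseteq> J <+>\<^bsub>R\<^esub> (A \<inter> B)"
    and I: "ideal I R" and J: "ideal J R" and K: "ideal K R"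
  shows "I \<inter> (J <+>\<^bsub>R\<^esub> K) = (I \<inter> J) <+>\<^bsub>R\<^esub> (I \<inter> K)"
proof
  have IJ: "ideal (I \<inter> J) R" and IK: "ideal (I \<inter> K) R"
    using i_intersect I J K by auto
  have comm: "A <+>\<^bsub>R\<^esub> B = B <+>\<^bsub>R\<^esub> A" if "ideal A R" "ideal B R" for A B
    using that by (intro set_add_comm) (auto dest: ideal.Icarr)
  have "I \<inter> (J <+>\<^bsub>R\<^esub> K) \<subseteq> I \<inter> ((K <+>\<^bsub>R\<^esub> I) \<inter> (K <+>\<^bsub>R\<^esub> J))"
    using set_add_ideal_upper2[OF K I] comm[OF J K] by auto
  also have "\<dots> \<subseteq> I \<inter> (K <+>\<^bsub>R\<^esub> (I \<inter> J))"
    using dist[OF K I J] by blast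
  also have "\<dots> \<subseteq> ((I \<inter> J) <+>\<^bsub>R\<^esub> I) \<inter> ((I \<inter> J) <+>\<^bsub>R\<^esub> K)"
    using set_add_ideal_upper2[OF IJ I] comm[OF K IJ] by auto
  also have "\<dots> \<subseteq> (I \<inter> J) <+>\<^bsub>R\<^esub> (I \<inter> K)"
    using dist[OF IJ I K] .
  finally show "I \<inter> (J <+>\<^bsub>R\<^esub> K) \<subseteq> (I \<inter> J) <+>\<^bsub>R\<^esub> (I \<inter> K)" .
  show "(I \<inter> J) <+>\<^bsub>R\<^esub> (I \<inter> K) \<subseteq> I \<inter> (J <+>\<^bsub>R\<^esub> K)"
    using set_add_ideal_upper1[OF J K] set_add_ideal_upper2[OF J K]
    by (intro set_add_ideal_least i_intersect I add_ideals J K) auto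
qed

end

theorem theorem5p4:
  fixes R :: "('a, 'm) ring_scheme"
  assumes "domain R"
    and "\<exists>(V :: 'v set) E. simple_graph V E \<and> connected_graph V E \<and>
           \<not> tree_graph V E \<and> \<not> cycle_graph V E \<and>
           (\<forall>\<alpha>. edge_labeling R E \<alpha> \<longrightarrow> universal_difference_property R V E \<alpha>)"
  shows "prufer_domain R"
proof -
  interpret domain R by fact
  obtain V :: "'v set" and E where graph: "simple_graph V E" "connected_graph V E"
      "\<not> tree_graph V E" "\<not> cycle_graph V E"
    and UDP: "\<And>\<alpha>. edge_labeling R E \<alpha> \<Longrightarrow> universal_difference_property R V E \<alpha>"
    using assms(2) by blast
  obtain s t v p q where "fork_configuration E s t v p q"
    using fork_configuration_exists[OF graph] .
  \<comment> \<open>A single fork serves all triples of ideals, since only the labels vary.\<close>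
  then have "(J <+>\<^bsub>R\<^esub> A) \<inter> (J <+>\<^bsub>R\<^esub> B) \<subseteq> J <+>\<^bsub>R\<^esub> (A \<inter> B)"
    if "ideal J R" "ideal A R" "ideal B R" for J A B
    using sum_inf_distrib_of_UDP[OF graph(1) _ UDP] that by blast
  then have "I \<inter> (J <+>\<^bsub>R\<^esub> K) = (I \<inter> J) <+>\<^bsub>R\<^esub> (I \<inter> K)"
    if "ideal I R" "ideal J R" "ideal K R" for I J K
    using inf_sum_distrib_of_sum_inf_distrib that by blast
  then show ?thesis
    using \<open>domain R\<close> unfolding prufer_domain_def by blast
qed

end
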